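(* Let $r=(r_n)_{n\ge 0}$ and $s=(s_n)_{n\ge 0}$ be monotonic increasing, unbounded sequences of positive real numbers, let $a=(a_n)_{n\ge0}$ be a complex sequence with $a_0\neq 0$ and $a_1\neq 0$, and suppose $T_a\in\mathcal B(h_r,h_s)$. Then $T_a$ is compact if and only if $$\limsup_{n\to\infty}\Big(\sup_{m\ge 0}\ \Gamma^{(r,s)}_{(m,n)}\Big)=0,$$ where $$\Gamma^{(r,s)}_{(m,n)}=\frac1{r_m}\Bigg(s_n\Big|\sum_{k=0}^{m}a_{n+1-k}\Big|+\sum_{t=n+1}^{\infty}s_t\,|a_{t-m}-a_{t+1}|\Bigg)$$ and $a_k=0$ for $k<0$.
   Context: All sequences are complex and indexed by $\mathbb N_0=\{0,1,2,\dots\}$. For a monotonic increasing, unbounded sequence $d=(d_n)$ of positive reals, the weighted Hahn space is $h_d=\{x\in\mathbb C^{\mathbb N_0}:\sum_{n=0}^\infty d_n|x_n-x_{n+1}|<\infty,\ \lim_n x_n=0\}$ with norm $\|x\|_{h_d}=\sum_{n=0}^\infty d_n|x_n-x_{n+1}|$; it is a Banach space. The convolution of sequences is $(a*x)_n=\sum_{k=0}^n a_{n-k}x_k$, and $T_a(x)=a*x$. The paper's convolution operators are defined for sequences $a$ with $a_0,a_1\ne0$. $\mathcal B(X,Y)$ is the space of bounded linear operators from $X$ to $Y$. *)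

theory Defs
  imports "HOL-Analysis.Analysis"
begin

text \<open>``Monotonic increasing'' is read in the weak (non-strict) sense.\<close>

definition hahn_weight :: "(nat \<Rightarrow> real) \<Rightarrow> bool" where
  "hahn_weight d \<longleftrightarrow> (\<forall>n. 0 < d n) \<and> incseq d \<and> \<not> bdd_above (range d)"

definition hahn_space :: "(nat \<Rightarrow> real) \<Rightarrow> (nat \<Rightarrow> complex) set" where
  "hahn_space d = {x. summable (\<lambda>n. d n * cmod (x n - x (Suc n))) \<and> x \<longlonglongrightarrow> 0}"

definition hahn_norm :: "(nat \<Rightarrow> real) \<Rightarrow> (nat \<Rightarrow> complex) \<Rightarrow> real" where
  "hahn_norm d x = (\<Sum>n. d n * cmod (x n - x (Suc n)))"

text \<open>The series in \<^const>\<open>hahn_norm\<close> carries no information off \<^const>\<open>hahn_space\<close>;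
  the locale \<^locale>\<open>Metric_space\<close> requires nonnegativity there too, hence the value 0.\<close>

definition hahn_dist :: "(nat \<Rightarrow> real) \<Rightarrow> (nat \<Rightarrow> complex) \<Rightarrow> (nat \<Rightarrow> complex) \<Rightarrow> real" where
  "hahn_dist d x y =
     (if x \<in> hahn_space d \<and> y \<in> hahn_space d then hahn_norm d (\<lambda>n. x n - y n) else 0)"

lemma hahn_space_diff:
  assumes w: "hahn_weight d" and x: "x \<in> hahn_space d" and y: "y \<in> hahn_space d"
  shows "(\<lambda>n. x n - y n) \<in> hahn_space d"
    and "hahn_norm d (\<lambda>n. x n - y n) \<le> hahn_norm d x + hahn_norm d y"
proof -
  define D where "D = (\<lambda>x n. d n * cmod (x n - x (Suc n)))"
  have pos: "0 < d n" for n using w by (simp add: hahn_weight_def)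
  have le: "D (\<lambda>n. x n - y n) n \<le> D x n + D y n" for n
  proof -
    have "cmod ((x n - y n) - (x (Suc n) - y (Suc n)))
        \<le> cmod (x n - x (Suc n)) + cmod (y n - y (Suc n))"
      using norm_triangle_ineq4[of "x n - x (Suc n)" "y n - y (Suc n)"]
      by (simp add: algebra_simps)
    from mult_left_mono[OF this less_imp_le[OF pos[of n]]] show ?thesis
      by (simp add: distrib_left D_def)
  qed
  have nn: "0 \<le> D z n" for z n using pos[of n] by (simp add: D_def)
  have sx: "summable (D x)" and sy: "summable (D y)"
    using x y by (auto simp: hahn_space_def D_def)
  have sxy: "summable (\<lambda>n. D x n + D y n)" by (rule summable_add[OF sx sy])
  have sd: "summable (D (\<lambda>n. x n - y n))"
    by (rule summable_comparison_test'[OF sxy, of 0]) (use le nn in auto)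
  moreover have "(\<lambda>n. x n - y n) \<longlonglongrightarrow> 0"
    using x y tendsto_diff[of x 0 sequentially y 0] by (auto simp: hahn_space_def)
  ultimately show "(\<lambda>n. x n - y n) \<in> hahn_space d" by (simp add: hahn_space_def D_def)
  have "suminf (D (\<lambda>n. x n - y n)) \<le> (\<Sum>n. D x n + D y n)"
    by (rule suminf_le[OF le sd sxy])
  also have "\<dots> = suminf (D x) + suminf (D y)" by (rule suminf_add[OF sx sy, symmetric])
  finally show "hahn_norm d (\<lambda>n. x n - y n) \<le> hahn_norm d x + hahn_norm d y"
    by (simp add: hahn_norm_def D_def)
qed

lemma hahn_norm_nonneg:
  assumes "hahn_weight d" "x \<in> hahn_space d"
  shows "0 \<le> hahn_norm d x"
  unfolding hahn_norm_def using assms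
  by (intro suminf_nonneg) (auto simp: hahn_space_def hahn_weight_def less_imp_le)

lemma hahn_norm_eq_0_iff:
  assumes w: "hahn_weight d" and x: "x \<in> hahn_space d"
  shows "hahn_norm d x = 0 \<longleftrightarrow> x = (\<lambda>_. 0)"
proof
  assume "hahn_norm d x = 0"
  moreover have "summable (\<lambda>n. d n * cmod (x n - x (Suc n)))" using x by (simp add: hahn_space_def)
  moreover have pos: "0 < d n" for n using w by (simp add: hahn_weight_def)
  ultimately have "d n * cmod (x n - x (Suc n)) = 0" for n
    unfolding hahn_norm_def by (subst (asm) suminf_eq_zero_iff) (auto simp: less_imp_le)
  then have "x (Suc n) = x n" for n
    using pos[of n] by (metis less_irrefl mult_eq_0_iff norm_eq_zero right_minus_eq)
  then have const: "x n = x 0" for n by (induction n) auto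
  have "x \<longlonglongrightarrow> 0" using x by (simp add: hahn_space_def)
  moreover have "x = (\<lambda>_. x 0)" using const by auto
  ultimately have "x 0 = 0" by (metis LIMSEQ_const_iff)
  then show "x = (\<lambda>_. 0)" using const by auto
qed (simp add: hahn_norm_def)

lemma Metric_space_hahn:
  assumes w: "hahn_weight d"
  shows "Metric_space (hahn_space d) (hahn_dist d)"
proof
  note mem = hahn_space_diff(1)[OF w]
  show "0 \<le> hahn_dist d x y" for x y
    by (simp add: hahn_dist_def hahn_norm_nonneg[OF w] mem)
  show commute: "hahn_dist d x y = hahn_dist d y x" for x y
  proof -
    have "cmod ((x n - y n) - (x (Suc n) - y (Suc n)))
        = cmod ((y n - x n) - (y (Suc n) - x (Suc n)))" for n
      by (subst norm_minus_cancel[symmetric]) (simp add: algebra_simps)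
    then show ?thesis by (auto simp: hahn_dist_def hahn_norm_def)
  qed
  show "hahn_dist d x y = 0 \<longleftrightarrow> x = y" if "x \<in> hahn_space d" "y \<in> hahn_space d" for x y
    using that by (auto simp: hahn_dist_def hahn_norm_eq_0_iff[OF w] mem fun_eq_iff)
  show "hahn_dist d x z \<le> hahn_dist d x y + hahn_dist d y z"
    if "x \<in> hahn_space d" "y \<in> hahn_space d" "z \<in> hahn_space d" for x y z
  proof -
    have "hahn_dist d x z = hahn_norm d (\<lambda>n. (x n - y n) - (z n - y n))"
      using that by (simp add: hahn_dist_def)
    also have "\<dots> \<le> hahn_dist d x y + hahn_dist d z y"
      using hahn_space_diff(2)[OF w mem mem, of x y z y] that by (simp add: hahn_dist_def)
    finally show ?thesis by (simp add: commute[of z y])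
  qed
qed

definition hahn_topology :: "(nat \<Rightarrow> real) \<Rightarrow> (nat \<Rightarrow> complex) topology" where
  "hahn_topology d = Metric_space.mtopology (hahn_space d) (hahn_dist d)"

definition bounded_hahn_operator ::
  "(nat \<Rightarrow> real) \<Rightarrow> (nat \<Rightarrow> real) \<Rightarrow> ((nat \<Rightarrow> complex) \<Rightarrow> (nat \<Rightarrow> complex)) \<Rightarrow> bool" where
  "bounded_hahn_operator r s T \<longleftrightarrow>
     T \<in> hahn_space r \<rightarrow> hahn_space s \<and>
     (\<forall>x\<in>hahn_space r. \<forall>y\<in>hahn_space r. T (\<lambda>n. x n + y n) = (\<lambda>n. T x n + T y n)) \<and>
     (\<forall>c. \<forall>x\<in>hahn_space r. T (\<lambda>n. c * x n) = (\<lambda>n. c * T x n)) \<and>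
     (\<exists>C. \<forall>x\<in>hahn_space r. hahn_norm s (T x) \<le> C * hahn_norm r x)"

definition compact_hahn_operator ::
  "(nat \<Rightarrow> real) \<Rightarrow> (nat \<Rightarrow> real) \<Rightarrow> ((nat \<Rightarrow> complex) \<Rightarrow> (nat \<Rightarrow> complex)) \<Rightarrow> bool" where
  "compact_hahn_operator r s T \<longleftrightarrow>
     bounded_hahn_operator r s T \<and>
     (\<forall>B. Metric_space.mbounded (hahn_space r) (hahn_dist r) B \<longrightarrow>
        compactin (hahn_topology s) (hahn_topology s closure_of (T ` B)))"

definition convolution_operator :: "(nat \<Rightarrow> complex) \<Rightarrow> (nat \<Rightarrow> complex) \<Rightarrow> (nat \<Rightarrow> complex)" where
  "convolution_operator a x = (\<lambda>n. \<Sum>k\<le>n. a (n - k) * x k)"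

definition zero_extend :: "(nat \<Rightarrow> complex) \<Rightarrow> int \<Rightarrow> complex" where
  "zero_extend a j = (if j < 0 then 0 else a (nat j))"

text \<open>The infinite sum over \<open>t \<ge> n + 1\<close> is indexed by \<open>t = n + 1 + j\<close>.  Values are taken in
  \<^typ>\<open>ennreal\<close>, so that divergent sums and unbounded suprema have the value \<open>\<infinity>\<close>.\<close>

definition Gamma_rs ::
  "(nat \<Rightarrow> real) \<Rightarrow> (nat \<Rightarrow> real) \<Rightarrow> (nat \<Rightarrow> complex) \<Rightarrow> nat \<Rightarrow> nat \<Rightarrow> ennreal" where
  "Gamma_rs r s a m n =
     ennreal (1 / r m) *
       (ennreal (s n * cmod (\<Sum>k\<le>m. zero_extend a (int n + 1 - int k))) +
        (\<Sum>j. let t = n + 1 + j in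
           ennreal (s t * cmod (zero_extend a (int t - int m) - zero_extend a (int t + 1)))))"

end

theory Submission
  imports Defs "HOL-Complex_Analysis.Great_Picard"
begin

text \<open>Write \<open>Q\<^sub>n\<close> for the map that sets the coordinates \<open>0, \<dots>, n\<close> of a sequence to \<open>0\<close>,
  and \<open>u\<^sub>m\<close> for the sequence \<open>(1, \<dots>, 1, 0, 0, \<dots>)\<close> with \<open>m + 1\<close> ones, which has norm \<open>r m\<close>
  in the domain.  Then \<open>\<Gamma> (m, n)\<close> is the norm of \<open>Q\<^sub>n (T u\<^sub>m)\<close> divided by \<open>r m\<close>.  The unit ball
  of the domain is the closed absolutely convex hull of the \<open>u\<^sub>m / r m\<close>, so the supremum over \<open>m\<close>
  is the operator norm of \<open>Q\<^sub>n \<circ> T\<close>.  Finally, a bounded subset of a weighted Hahn space is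
  totally bounded iff its tails \<open>Q\<^sub>n y\<close> tend to \<open>0\<close> uniformly, and the space is complete.\<close>

section \<open>Weighted Hahn spaces\<close>

lemma hahn_weight_pos: "hahn_weight d \<Longrightarrow> 0 < d n"
  by (simp add: hahn_weight_def)

lemma hahn_weight_mono: "hahn_weight d \<Longrightarrow> m \<le> n \<Longrightarrow> d m \<le> d n"
  by (auto simp: hahn_weight_def incseq_def)

lemma hahn_weight_at_top:
  assumes "hahn_weight d"
  shows "filterlim d at_top sequentially"
  unfolding filterlim_at_top eventually_sequentially
proof
  fix Z
  obtain N where "Z < d N"
    using assms by (auto simp: hahn_weight_def bdd_above_def not_le)
  then show "\<exists>N. \<forall>n\<ge>N. Z \<le> d n"
    by (meson assms hahn_weight_mono less_imp_le order_trans)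
qed

lemma hahn_space_scale:
  assumes "x \<in> hahn_space d"
  shows "(\<lambda>n. c * x n) \<in> hahn_space d"
    and "hahn_norm d (\<lambda>n. c * x n) = cmod c * hahn_norm d x"
proof -
  have eq: "d n * cmod (c * x n - c * x (Suc n)) = cmod c * (d n * cmod (x n - x (Suc n)))" for n
    by (simp add: norm_mult flip: right_diff_distrib)
  have sm: "summable (\<lambda>n. d n * cmod (x n - x (Suc n)))"
    using assms by (simp add: hahn_space_def)
  show "(\<lambda>n. c * x n) \<in> hahn_space d"
    using assms tendsto_mult_right_zero[of x sequentially c] summable_mult[OF sm, of "cmod c"]
    by (simp add: hahn_space_def eq)
  show "hahn_norm d (\<lambda>n. c * x n) = cmod c * hahn_norm d x"
    unfolding hahn_norm_def eq by (rule suminf_mult[OF sm])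
qed

lemma hahn_space_zero: "(\<lambda>_. 0) \<in> hahn_space d" "hahn_norm d (\<lambda>_. 0) = 0"
  by (simp_all add: hahn_space_def hahn_norm_def)

lemma hahn_space_add:
  assumes w: "hahn_weight d" and x: "x \<in> hahn_space d" and y: "y \<in> hahn_space d"
  shows "(\<lambda>n. x n + y n) \<in> hahn_space d"
    and "hahn_norm d (\<lambda>n. x n + y n) \<le> hahn_norm d x + hahn_norm d y"
  using hahn_space_diff[OF w x hahn_space_scale(1)[OF y, of "-1"]]
    hahn_space_scale(2)[OF y, of "-1"] by simp_all

text \<open>Meant for the partial sums that arise from summation by parts: the triangle inequality
  bounds their norm by the coefficients, whatever the number of terms.\<close>

lemma hahn_space_sum:
  fixes M :: nat
  assumes w: "hahn_weight d" and f: "\<And>m. f m \<in> hahn_space d"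
  shows "(\<lambda>t. \<Sum>m<M. c m * f m t) \<in> hahn_space d \<and>
    hahn_norm d (\<lambda>t. \<Sum>m<M. c m * f m t) \<le> (\<Sum>m<M. cmod (c m) * hahn_norm d (f m))"
proof (induction M)
  case 0
  then show ?case by (simp add: hahn_space_zero)
next
  case (Suc M)
  then show ?case
    using hahn_space_add[OF w, of "\<lambda>t. \<Sum>m<M. c m * f m t" "\<lambda>t. c M * f M t"]
      hahn_space_scale[OF f, of "c M" M]
    by auto
qed

lemma hahn_norm_minus:
  assumes "x \<in> hahn_space d"
  shows "hahn_norm d (\<lambda>n. y n - x n) = hahn_norm d (\<lambda>n. x n - y n)"
proof -
  have "cmod ((y n - x n) - (y (Suc n) - x (Suc n))) =
      cmod ((x n - y n) - (x (Suc n) - y (Suc n)))" for n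
    by (subst norm_minus_cancel[symmetric]) (simp add: algebra_simps)
  then show ?thesis by (simp add: hahn_norm_def)
qed

section \<open>Coordinate estimates, coordinatewise limits and completeness\<close>

lemma hahn_coord_tail_bound:
  assumes w: "hahn_weight d" and x: "x \<in> hahn_space d"
  shows "d n * cmod (x n) \<le> (\<Sum>j. d (j + n) * cmod (x (j + n) - x (Suc (j + n))))"
proof -
  let ?\<Delta> = "\<lambda>j. x (j + n) - x (Suc (j + n))"
  have lim: "x \<longlonglongrightarrow> 0" and "summable (\<lambda>n. d n * cmod (x n - x (Suc n)))"
    using x by (auto simp: hahn_space_def)
  then have sm: "summable (\<lambda>j. d (j + n) * cmod (?\<Delta> j))"
    using summable_iff_shift[of "\<lambda>n. d n * cmod (x n - x (Suc n))" n] by simp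
  have le: "d n * cmod (?\<Delta> j) \<le> d (j + n) * cmod (?\<Delta> j)" for j
    by (intro mult_right_mono hahn_weight_mono[OF w]) auto
  have sm': "summable (\<lambda>j. d n * cmod (?\<Delta> j))"
    by (rule summable_comparison_test'[OF sm, of 0])
      (use le hahn_weight_pos[OF w, of n] in auto)
  then have sm'': "summable (\<lambda>j. cmod (?\<Delta> j))"
    using hahn_weight_pos[OF w, of n] by (simp add: summable_cmult_iff)
  \<comment> \<open>As \<open>x\<close> tends to 0, the coordinate \<open>x n\<close> is the
    telescoping sum of all later differences. Monotonicity of the weight then lets
    \<open>d n\<close> be replaced by \<open>d (j + n)\<close> inside the sum.\<close>
  have "?\<Delta> sums (x n - 0)"
    using telescope_sums'[of "\<lambda>j. x (j + n)" 0] LIMSEQ_ignore_initial_segment[OF lim, of n]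
    by simp
  then have "cmod (x n) \<le> (\<Sum>j. cmod (?\<Delta> j))"
    using summable_norm[OF sm''] by (simp add: sums_iff)
  then have "d n * cmod (x n) \<le> d n * (\<Sum>j. cmod (?\<Delta> j))"
    using hahn_weight_pos[OF w, of n] by simp
  also have "\<dots> = (\<Sum>j. d n * cmod (?\<Delta> j))" using suminf_mult[OF sm''] by simp
  also have "\<dots> \<le> (\<Sum>j. d (j + n) * cmod (?\<Delta> j))"
    by (rule suminf_le[OF le sm' sm])
  finally show ?thesis .
qed

text \<open>The tail series is at most the whole series, its terms being nonnegative. Norm-bounded
  sets therefore decay uniformly like \<open>1 / d n\<close>, and coordinates are continuous in the
  norm.\<close>

lemma hahn_coord_bound:
  assumes w: "hahn_weight d" and x: "x \<in> hahn_space d"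
  shows "d n * cmod (x n) \<le> hahn_norm d x"
proof -
  have "summable (\<lambda>n. d n * cmod (x n - x (Suc n)))"
    using x by (auto simp: hahn_space_def)
  from suminf_split_initial_segment[OF this, of n]
  have "(\<Sum>j. d (j + n) * cmod (x (j + n) - x (Suc (j + n)))) \<le> hahn_norm d x"
    using hahn_weight_pos[OF w] by (simp add: hahn_norm_def sum_nonneg less_imp_le)
  with hahn_coord_tail_bound[OF w x, of n] show ?thesis by linarith
qed

text \<open>Unboundedness of the weight forces the limit to be a null sequence:
  the bound \<open>d n * cmod (y n) \<le> C\<close> survives pointwise limits.\<close>

lemma hahn_fatou:
  assumes w: "hahn_weight d" and z: "\<And>k. z k \<in> hahn_space d"
    and C: "\<And>k. hahn_norm d (z k) \<le> C" and lim: "\<And>n. (\<lambda>k. z k n) \<longlonglongrightarrow> y n"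
  shows "y \<in> hahn_space d" "hahn_norm d y \<le> C"
proof -
  let ?D = "\<lambda>x n. d n * cmod (x n - x (Suc n))"
  have nn: "0 \<le> ?D x n" for x n using hahn_weight_pos[OF w, of n] by simp
  have part: "(\<Sum>n<N. ?D y n) \<le> C" for N
  proof (rule LIMSEQ_le_const2)
    show "(\<lambda>k. \<Sum>n<N. ?D (z k) n) \<longlonglongrightarrow> (\<Sum>n<N. ?D y n)"
      by (intro tendsto_intros lim)
    have "(\<Sum>n<N. ?D (z k) n) \<le> C" for k
    proof -
      have "(\<Sum>n<N. ?D (z k) n) \<le> hahn_norm d (z k)"
        unfolding hahn_norm_def
        by (rule sum_le_suminf) (use z[of k] nn in \<open>auto simp: hahn_space_def\<close>)
      with C[of k] show ?thesis by linarith
    qed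
    then show "\<exists>K. \<forall>k\<ge>K. (\<Sum>n<N. ?D (z k) n) \<le> C" by blast
  qed
  have sm: "summable (?D y)" by (rule summableI_nonneg_bounded[OF nn part])
  show "hahn_norm d y \<le> C"
    unfolding hahn_norm_def by (rule suminf_le_const[OF sm part])
  have coord: "cmod (y n) \<le> C / d n" for n
  proof (rule LIMSEQ_le_const2)
    show "(\<lambda>k. cmod (z k n)) \<longlonglongrightarrow> cmod (y n)" by (intro tendsto_intros lim)
    have "cmod (z k n) \<le> C / d n" for k
      using hahn_coord_bound[OF w z, of n k] C[of k] hahn_weight_pos[OF w, of n]
      by (simp add: pos_le_divide_eq mult.commute)
    then show "\<exists>K. \<forall>k\<ge>K. cmod (z k n) \<le> C / d n" by blast
  qed
  have "(\<lambda>n. C / d n) \<longlonglongrightarrow> 0"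
    by (rule real_tendsto_divide_at_top[OF tendsto_const hahn_weight_at_top[OF w]])
  then have "y \<longlonglongrightarrow> 0"
    by (rule Lim_null_comparison[rotated]) (use coord in simp)
  with sm show "y \<in> hahn_space d" by (simp add: hahn_space_def)
qed

text \<open>A Cauchy sequence is Cauchy in each coordinate, which yields a candidate limit;
  \<open>hahn_fatou\<close>, applied to differences, turns coordinatewise convergence into norm
  convergence.\<close>

lemma hahn_mcomplete:
  assumes w: "hahn_weight d"
  shows "Metric_space.mcomplete (hahn_space d) (hahn_dist d)"
proof -
  interpret Metric_space "hahn_space d" "hahn_dist d" by (rule Metric_space_hahn[OF w])
  have "\<exists>x. limitin mtopology \<sigma> x sequentially" if "MCauchy \<sigma>" for \<sigma>
  proof -
    have mem: "\<sigma> k \<in> hahn_space d" for k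
      using that by (auto simp: MCauchy_def)
    note mem2 = hahn_space_diff(1)[OF w mem mem]
    have cau: "\<exists>N. \<forall>i\<ge>N. \<forall>j\<ge>N. hahn_norm d (\<lambda>n. \<sigma> i n - \<sigma> j n) < e" if "0 < e" for e
      using \<open>MCauchy \<sigma>\<close> that by (simp add: MCauchy_def hahn_dist_def mem)
    have "Cauchy (\<lambda>k. \<sigma> k n)" for n
    proof (rule metric_CauchyI)
      fix e :: real assume "0 < e"
      have p: "0 < d n" by (rule hahn_weight_pos[OF w])
      then obtain N where N: "\<And>i j. i \<ge> N \<Longrightarrow> j \<ge> N \<Longrightarrow>
          hahn_norm d (\<lambda>n. \<sigma> i n - \<sigma> j n) < d n * e"
        using cau[of "d n * e"] \<open>0 < e\<close> by (meson mult_pos_pos)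
      have "dist (\<sigma> i n) (\<sigma> j n) < e" if "i \<ge> N" "j \<ge> N" for i j
        using hahn_coord_bound[OF w mem2, of n i j] N[OF that] p
        unfolding dist_norm by (meson le_less_trans mult_less_cancel_left_pos)
      then show "\<exists>N. \<forall>i\<ge>N. \<forall>j\<ge>N. dist (\<sigma> i n) (\<sigma> j n) < e" by blast
    qed
    then have "\<forall>n. \<exists>l. (\<lambda>k. \<sigma> k n) \<longlonglongrightarrow> l"
      using Cauchy_convergent_iff convergent_def by blast
    then obtain y where y: "\<And>n. (\<lambda>k. \<sigma> k n) \<longlonglongrightarrow> y n" by metis
    \<comment> \<open>Keep \<open>i\<close> fixed and let \<open>j\<close> tend to infinity in the
      Cauchy estimate. The shift by \<open>N\<close> makes the bound hold for every index, as
      \<open>hahn_fatou\<close> requires.\<close>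
    have close: "(\<lambda>n. \<sigma> i n - y n) \<in> hahn_space d"
        "hahn_norm d (\<lambda>n. \<sigma> i n - y n) \<le> e"
      if N: "\<And>j. j \<ge> N \<Longrightarrow> hahn_norm d (\<lambda>n. \<sigma> i n - \<sigma> j n) < e" for i N e
    proof -
      have "hahn_norm d (\<lambda>n. \<sigma> i n - \<sigma> (j + N) n) \<le> e" for j
        using N[of "j + N"] by simp
      moreover have "(\<lambda>j. \<sigma> i n - \<sigma> (j + N) n) \<longlonglongrightarrow> \<sigma> i n - y n" for n
        by (intro tendsto_intros LIMSEQ_ignore_initial_segment y)
      ultimately show "(\<lambda>n. \<sigma> i n - y n) \<in> hahn_space d"
        "hahn_norm d (\<lambda>n. \<sigma> i n - y n) \<le> e"
        using hahn_fatou[OF w, of "\<lambda>j n. \<sigma> i n - \<sigma> (j + N) n" e "\<lambda>n. \<sigma> i n - y n"] mem2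
        by auto
    qed
    obtain N where N: "\<And>j. j \<ge> N \<Longrightarrow> hahn_norm d (\<lambda>n. \<sigma> N n - \<sigma> j n) < 1"
      using cau[of 1] by auto
    have ymem: "y \<in> hahn_space d"
      using hahn_space_diff(1)[OF w mem[of N] close(1)[OF N]] by simp
    have "limitin mtopology \<sigma> y sequentially"
      unfolding limit_metric_sequentially
    proof (intro conjI allI impI ymem)
      fix e :: real assume "0 < e"
      then obtain K where K: "\<And>i j. i \<ge> K \<Longrightarrow> j \<ge> K \<Longrightarrow>
          hahn_norm d (\<lambda>n. \<sigma> i n - \<sigma> j n) < e / 2"
        using cau[of "e / 2"] by auto
      have "\<sigma> i \<in> hahn_space d \<and> hahn_dist d (\<sigma> i) y < e" if "i \<ge> K" for i
        using close(2)[of K i "e / 2"] K[OF that] \<open>0 < e\<close>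
        by (auto simp: hahn_dist_def mem ymem)
      then show "\<exists>N. \<forall>n\<ge>N. \<sigma> n \<in> hahn_space d \<and> hahn_dist d (\<sigma> n) y < e" by blast
    qed
    then show ?thesis by blast
  qed
  then show ?thesis by (simp add: mcomplete_def)
qed

section \<open>Tails\<close>

text \<open>The cut leaves the coordinates from \<open>n + 1\<close> on. The jump that it creates
  sits at index \<open>n\<close> and carries the weight \<open>d n\<close>, whence the isolated
  first term of \<open>Gamma_rs\<close>.\<close>

definition seq_tail :: "nat \<Rightarrow> (nat \<Rightarrow> complex) \<Rightarrow> nat \<Rightarrow> complex" where
  "seq_tail n y = (\<lambda>t. if t \<le> n then 0 else y t)"

lemma seq_tail_diff: "seq_tail n (\<lambda>t. x t - y t) = (\<lambda>t. seq_tail n x t - seq_tail n y t)"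
  by (auto simp: seq_tail_def)

lemma hahn_tail:
  assumes w: "hahn_weight d" and y: "y \<in> hahn_space d"
  shows hahn_tail_mem: "seq_tail n y \<in> hahn_space d"
    and hahn_tail_norm: "hahn_norm d (seq_tail n y) = d n * cmod (y (Suc n)) +
      (\<Sum>j. d (j + Suc n) * cmod (y (j + Suc n) - y (Suc (j + Suc n))))"
proof -
  let ?D = "\<lambda>x n. d n * cmod (x n - x (Suc n))"
  have sm: "summable (?D y)" and lim: "y \<longlonglongrightarrow> 0" using y by (auto simp: hahn_space_def)
  have sh: "?D (seq_tail n y) (j + Suc n) = ?D y (j + Suc n)" for j
    by (simp add: seq_tail_def)
  have "summable (\<lambda>j. ?D y (j + Suc n))" using sm by (subst summable_iff_shift)
  then have sm': "summable (?D (seq_tail n y))"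
    unfolding sh[symmetric] by (subst (asm) summable_iff_shift)
  have "seq_tail n y \<longlonglongrightarrow> 0"
    using lim by (rule Lim_transform_eventually)
      (auto simp: seq_tail_def eventually_sequentially intro!: exI[of _ "Suc n"])
  with sm' show "seq_tail n y \<in> hahn_space d" by (simp add: hahn_space_def)
  have "(\<Sum>i<n. ?D (seq_tail n y) i) = 0"
    by (intro sum.neutral) (auto simp: seq_tail_def)
  then have "(\<Sum>i<Suc n. ?D (seq_tail n y) i) = d n * cmod (y (Suc n))"
    by (simp add: seq_tail_def)
  then show "hahn_norm d (seq_tail n y) = d n * cmod (y (Suc n)) +
      (\<Sum>j. d (j + Suc n) * cmod (y (j + Suc n) - y (Suc (j + Suc n))))"
    unfolding hahn_norm_def using suminf_split_initial_segment[OF sm', of "Suc n"]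
    by (simp only: sh)
qed

text \<open>The jump at the cut is itself a telescoping sum of the later differences, so it costs at
  most one more copy of the remainder series.\<close>

lemma hahn_tail_norm_bound:
  assumes w: "hahn_weight d" and y: "y \<in> hahn_space d"
  shows "hahn_norm d (seq_tail n y) \<le>
    2 * (\<Sum>j. d (j + Suc n) * cmod (y (j + Suc n) - y (Suc (j + Suc n))))"
proof -
  have "d n * cmod (y (Suc n)) \<le> d (Suc n) * cmod (y (Suc n))"
    by (intro mult_right_mono hahn_weight_mono[OF w]) auto
  with hahn_coord_tail_bound[OF w y, of "Suc n"] hahn_tail_norm[OF w y, of n]
  show ?thesis by linarith
qed

text \<open>Truncation is bounded uniformly in \<open>n\<close>, which allows smallness of tails to
  pass from a finite net to all points near it.\<close>

lemma hahn_tail_norm_le: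
  assumes w: "hahn_weight d" and y: "y \<in> hahn_space d"
  shows "hahn_norm d (seq_tail n y) \<le> 2 * hahn_norm d y"
proof -
  have "summable (\<lambda>n. d n * cmod (y n - y (Suc n)))"
    using y by (auto simp: hahn_space_def)
  from suminf_split_initial_segment[OF this, of "Suc n"]
  have "(\<Sum>j. d (j + Suc n) * cmod (y (j + Suc n) - y (Suc (j + Suc n)))) \<le> hahn_norm d y"
    using hahn_weight_pos[OF w] sum_nonneg[of "{..<Suc n}" "\<lambda>n. d n * cmod (y n - y (Suc n))"]
    by (simp add: hahn_norm_def less_imp_le)
  with hahn_tail_norm_bound[OF w y, of n] show ?thesis by linarith
qed

lemma hahn_tail_norm_tendsto_0:
  assumes w: "hahn_weight d" and y: "y \<in> hahn_space d"
  shows "(\<lambda>n. hahn_norm d (seq_tail n y)) \<longlonglongrightarrow> 0"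
proof -
  let ?D = "\<lambda>n. d n * cmod (y n - y (Suc n))"
  have "summable ?D" using y by (auto simp: hahn_space_def)
  from LIMSEQ_Suc[OF suminf_exist_split2[OF this]]
  have "(\<lambda>n. 2 * (\<Sum>j. ?D (j + Suc n))) \<longlonglongrightarrow> 0"
    by (rule tendsto_mult_right_zero)
  then show ?thesis
    by (rule Lim_null_comparison[rotated])
      (use hahn_tail_norm_bound[OF w y] hahn_norm_nonneg[OF w hahn_tail_mem[OF w y]]
        in \<open>auto intro!: always_eventually\<close>)
qed

text \<open>The head vanishes beyond \<open>n\<close>, so its norm is a finite sum and is governed
  by coordinatewise convergence alone.\<close>

lemma hahn_head:
  assumes w: "hahn_weight d" and y: "y \<in> hahn_space d"
  shows "hahn_norm d (\<lambda>t. y t - seq_tail n y t) =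
    (\<Sum>t\<le>n. d t * cmod ((y t - seq_tail n y t) - (y (Suc t) - seq_tail n y (Suc t))))"
  unfolding hahn_norm_def by (rule suminf_finite) (auto simp: seq_tail_def)

section \<open>Total boundedness via tails\<close>

text \<open>The tails of the finitely many points of a net become small simultaneously, and every
  other point differs from one of these by little.\<close>

lemma hahn_mtotally_bounded_imp_tails:
  assumes w: "hahn_weight d"
    and tb: "Metric_space.mtotally_bounded (hahn_space d) (hahn_dist d) S" and e: "0 < e"
  shows "\<forall>\<^sub>F n in sequentially. \<forall>y\<in>S. hahn_norm d (seq_tail n y) < e"
proof -
  interpret Metric_space "hahn_space d" "hahn_dist d" by (rule Metric_space_hahn[OF w])
  \<comment> \<open>The radius \<open>e / 4\<close> allows for the factor 2 lost by truncating
    \<open>y - k\<close>; the tails of net points contribute the other \<open>e / 2\<close>.\<close>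
  obtain K where K: "finite K" "K \<subseteq> S" "S \<subseteq> (\<Union>x\<in>K. mball x (e / 4))"
    using tb e unfolding mtotally_bounded_def by (meson zero_less_divide_iff zero_less_numeral)
  have sub: "S \<subseteq> hahn_space d" using tb by (rule mtotally_bounded_imp_subset)
  have "\<forall>\<^sub>F n in sequentially. hahn_norm d (seq_tail n k) < e / 2" if "k \<in> K" for k
    using order_tendstoD(2)[OF hahn_tail_norm_tendsto_0[OF w, of k], of "e / 2"] that K sub e
    by auto
  then have "\<forall>\<^sub>F n in sequentially. \<forall>k\<in>K. hahn_norm d (seq_tail n k) < e / 2"
    using K(1) by (simp add: eventually_ball_finite)
  then show ?thesis
  proof eventually_elim
    case (elim n)
    show ?case
    proof
      fix y assume "y \<in> S"
      then obtain k where k: "k \<in> K" "y \<in> mball k (e / 4)" using K by blast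
      have mem: "y \<in> hahn_space d" "k \<in> hahn_space d"
        using \<open>y \<in> S\<close> k K sub by auto
      have "hahn_norm d (\<lambda>t. k t - y t) < e / 4"
        using k(2) mem by (simp add: hahn_dist_def)
      then have yk: "hahn_norm d (\<lambda>t. y t - k t) < e / 4"
        using hahn_norm_minus[OF mem(2), of y] by simp
      note mem' = hahn_space_diff(1)[OF w mem]
      have "hahn_norm d (seq_tail n y) \<le>
          hahn_norm d (seq_tail n (\<lambda>t. y t - k t)) + hahn_norm d (seq_tail n k)"
        using hahn_space_add(2)[OF w hahn_tail_mem[OF w mem'] hahn_tail_mem[OF w mem(2)], of n n]
        by (simp add: seq_tail_diff)
      also have "\<dots> < 2 * (e / 4) + e / 2"
        using hahn_tail_norm_le[OF w mem', of n] yk elim k(1) by fastforce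
      finally show "hahn_norm d (seq_tail n y) < e" by simp
    qed
  qed
qed

text \<open>By the sequential criterion it suffices to extract Cauchy subsequences. A diagonal
  subsequence converges in every coordinate, which controls the heads; the tails are uniformly small
  by assumption.\<close>

lemma hahn_mtotally_bounded_if_tails:
  assumes w: "hahn_weight d" and sub: "S \<subseteq> hahn_space d"
    and C: "\<And>y. y \<in> S \<Longrightarrow> hahn_norm d y \<le> C"
    and tails: "\<And>e. 0 < e \<Longrightarrow> \<exists>n. \<forall>y\<in>S. hahn_norm d (seq_tail n y) \<le> e"
  shows "Metric_space.mtotally_bounded (hahn_space d) (hahn_dist d) S"
proof -
  interpret Metric_space "hahn_space d" "hahn_dist d" by (rule Metric_space_hahn[OF w])
  have "\<exists>k. strict_mono k \<and> MCauchy (\<sigma> \<circ> k)" if \<sigma>: "range \<sigma> \<subseteq> S" for \<sigma> :: "nat \<Rightarrow> nat \<Rightarrow> complex"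
  proof -
    have \<sigma>S: "\<sigma> i \<in> S" for i using \<sigma> by auto
    have mem: "\<sigma> i \<in> hahn_space d" for i using \<sigma>S sub by auto
    note mem2 = hahn_space_diff(1)[OF w mem mem]
    \<comment> \<open>The diagonal extraction asks for one bound valid for all coordinates, hence
      \<open>C / d 0\<close> in place of the sharper \<open>C / d n\<close>.\<close>
    have "cmod (\<sigma> i n) \<le> C / d 0" for i n
    proof -
      have "d 0 * cmod (\<sigma> i n) \<le> d n * cmod (\<sigma> i n)"
        by (intro mult_right_mono hahn_weight_mono[OF w]) auto
      then have "d 0 * cmod (\<sigma> i n) \<le> C"
        using hahn_coord_bound[OF w mem, of n i] C[OF \<sigma>S, of i] by linarith
      then show ?thesis
        using hahn_weight_pos[OF w, of 0] by (simp add: pos_le_divide_eq mult.commute)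
    qed
    then obtain k where k: "strict_mono k"
      and conv: "\<And>n. \<exists>l. (\<lambda>i. \<sigma> (k i) n) \<longlonglongrightarrow> l"
      using function_convergent_subsequence[of "UNIV :: nat set" \<sigma> "C / d 0"]
      by (metis UNIV_I countableI_type)
    obtain l where l: "\<And>n. (\<lambda>i. \<sigma> (k i) n) \<longlonglongrightarrow> l n" using conv by metis
    have "MCauchy (\<sigma> \<circ> k)"
      unfolding MCauchy_def
    proof (intro conjI allI impI)
      show "range (\<sigma> \<circ> k) \<subseteq> hahn_space d" using mem by auto
      fix e :: real assume "0 < e"
      \<comment> \<open>Two tails of size \<open>e / 8\<close> give at most \<open>e / 4\<close>,
        and two head terms below \<open>e / 4\<close> give less than \<open>e / 2\<close>; the total
        stays below \<open>e\<close>.\<close>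
      then obtain n where n: "\<And>y. y \<in> S \<Longrightarrow> hahn_norm d (seq_tail n y) \<le> e / 8"
        using tails[of "e / 8"] by auto
      \<comment> \<open>\<open>H\<close> measures the head as a plain finite sum, so it applies to
        differences with the coordinatewise limit \<open>l\<close>, whose membership in the space
        has not been established.\<close>
      define H where "H = (\<lambda>y. \<Sum>t\<le>n. d t *
        cmod ((y t - seq_tail n y t) - (y (Suc t) - seq_tail n y (Suc t))))"
      have tl: "(\<lambda>i. seq_tail n (\<lambda>t. \<sigma> (k i) t - l t) t) \<longlonglongrightarrow> 0" for t
        using LIM_zero[OF l, of t] by (cases "t \<le> n") (simp_all add: seq_tail_def)
      have "(\<lambda>i. H (\<lambda>t. \<sigma> (k i) t - l t)) \<longlonglongrightarrow>
          (\<Sum>t\<le>n. d t * cmod ((0 - 0) - (0 - 0)))"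
        unfolding H_def by (intro tendsto_intros tl LIM_zero[OF l])
      then have "(\<lambda>i. H (\<lambda>t. \<sigma> (k i) t - l t)) \<longlonglongrightarrow> 0" by simp
      then have "\<forall>\<^sub>F i in sequentially. H (\<lambda>t. \<sigma> (k i) t - l t) < e / 4"
        using order_tendstoD(2)[of _ 0 _ "e / 4"] \<open>0 < e\<close> by simp
      then obtain N where N: "\<And>i. i \<ge> N \<Longrightarrow> H (\<lambda>t. \<sigma> (k i) t - l t) < e / 4"
        by (auto simp: eventually_sequentially)
      have Hdiff: "H (\<lambda>t. x t - y t) \<le> H (\<lambda>t. x t - l t) + H (\<lambda>t. y t - l t)" for x y
      proof -
        have "cmod ((x t - y t - seq_tail n (\<lambda>t. x t - y t) t) -
              (x (Suc t) - y (Suc t) - seq_tail n (\<lambda>t. x t - y t) (Suc t))) \<le>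
            cmod ((x t - l t - seq_tail n (\<lambda>t. x t - l t) t) -
              (x (Suc t) - l (Suc t) - seq_tail n (\<lambda>t. x t - l t) (Suc t))) +
            cmod ((y t - l t - seq_tail n (\<lambda>t. y t - l t) t) -
              (y (Suc t) - l (Suc t) - seq_tail n (\<lambda>t. y t - l t) (Suc t)))" for t
          by (rule order_trans[OF _ norm_triangle_ineq4]) (simp add: seq_tail_def algebra_simps)
        then show ?thesis
          unfolding H_def sum.distrib[symmetric] distrib_left[symmetric]
          using hahn_weight_pos[OF w] by (intro sum_mono mult_left_mono) (auto simp: less_imp_le)
      qed
      have "hahn_dist d ((\<sigma> \<circ> k) i) ((\<sigma> \<circ> k) j) < e" if "N \<le> i" "N \<le> j" for i j
      proof -
        let ?z = "\<lambda>t. \<sigma> (k i) t - \<sigma> (k j) t"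
        have "hahn_norm d (seq_tail n ?z) \<le> e / 4"
          using hahn_space_diff(2)[OF w hahn_tail_mem[OF w mem] hahn_tail_mem[OF w mem],
              of n "k i" n "k j"] n[OF \<sigma>S, of "k i"] n[OF \<sigma>S, of "k j"]
          by (simp add: seq_tail_diff)
        moreover have "hahn_norm d (\<lambda>t. ?z t - seq_tail n ?z t) < e / 2"
          using hahn_head[OF w mem2[of "k i" "k j"], of n] Hdiff[of "\<sigma> (k i)" "\<sigma> (k j)"]
            N[OF that(1)] N[OF that(2)] unfolding H_def by linarith
        moreover have "hahn_norm d ?z \<le>
            hahn_norm d (\<lambda>t. ?z t - seq_tail n ?z t) + hahn_norm d (seq_tail n ?z)"
          using hahn_space_add(2)[OF w hahn_space_diff(1)[OF w mem2 hahn_tail_mem[OF w mem2]]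
              hahn_tail_mem[OF w mem2], of "k i" "k j" n "k i" "k j" n "k i" "k j"]
          by simp
        ultimately show ?thesis using \<open>0 < e\<close> by (simp add: hahn_dist_def mem)
      qed
      then show "\<exists>N. \<forall>i j. N \<le> i \<longrightarrow> N \<le> j \<longrightarrow>
          hahn_dist d ((\<sigma> \<circ> k) i) ((\<sigma> \<circ> k) j) < e" by blast
    qed
    with k show ?thesis by blast
  qed
  with sub show ?thesis by (auto simp: mtotally_bounded_sequentially)
qed

section \<open>Convolution operators\<close>

definition initial_ones :: "nat \<Rightarrow> nat \<Rightarrow> complex" where
  "initial_ones m = (\<lambda>k. if k \<le> m then 1 else 0)"

text \<open>The only nonzero difference is the jump at index \<open>m\<close>.\<close>

lemma hahn_initial_ones:
  shows hahn_initial_ones_mem: "initial_ones m \<in> hahn_space d"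
    and hahn_initial_ones_norm: "hahn_norm d (initial_ones m) = d m"
proof -
  have eq: "(\<lambda>n. d n * cmod (initial_ones m n - initial_ones m (Suc n))) =
      (\<lambda>n. if n = m then d n else 0)"
    by (auto simp: initial_ones_def)
  have "initial_ones m \<longlonglongrightarrow> 0"
    by (rule tendsto_eventually)
      (auto simp: initial_ones_def eventually_sequentially intro!: exI[of _ "Suc m"])
  then show "initial_ones m \<in> hahn_space d"
    by (simp add: hahn_space_def eq)
  show "hahn_norm d (initial_ones m) = d m"
    unfolding hahn_norm_def eq using sums_single[of m d] by (simp add: sums_iff)
qed

text \<open>Extending \<open>a\<close> by 0 to negative indices makes the range of summation
  independent of \<open>t\<close>: the terms with \<open>k > t\<close> vanish. At
  \<open>t = n + 1\<close> this is the inner sum of \<open>Gamma_rs\<close>.\<close>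

lemma convolution_initial_ones:
  "convolution_operator a (initial_ones m) t = (\<Sum>k\<le>m. zero_extend a (int t - int k))"
proof -
  have "convolution_operator a (initial_ones m) t =
      (\<Sum>k\<in>{..t} \<inter> {..m}. zero_extend a (int t - int k))"
    unfolding convolution_operator_def
    by (rule sum.mono_neutral_cong_right)
      (auto simp: initial_ones_def zero_extend_def simp flip: of_nat_diff)
  also have "\<dots> = (\<Sum>k\<le>m. zero_extend a (int t - int k))"
    by (rule sum.mono_neutral_left) (auto simp: zero_extend_def)
  finally show ?thesis .
qed

text \<open>Both values sum \<open>a\<close> over windows of length \<open>m + 1\<close>, shifted by
  one against each other, so only the two end terms survive.\<close>

lemma convolution_initial_ones_diff:
  "convolution_operator a (initial_ones m) t - convolution_operator a (initial_ones m) (Suc t) =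
    zero_extend a (int t - int m) - zero_extend a (int t + 1)"
proof -
  have "(\<Sum>k\<le>m. zero_extend a (int t - int k)) - (\<Sum>k\<le>m. zero_extend a (int (Suc t) - int k)) =
      zero_extend a (int t - int m) - zero_extend a (int t + 1)"
    by (induction m) (auto simp: algebra_simps)
  then show ?thesis by (simp add: convolution_initial_ones)
qed

text \<open>The two summands of \<open>Gamma_rs\<close> are the jump and the remainder in
  \<open>hahn_tail_norm\<close>. Membership in the space makes the series converge, so the extended
  value is that of a real number.\<close>

lemma Gamma_rs_eq:
  assumes r: "hahn_weight r" and s: "hahn_weight s"
    and mem: "convolution_operator a (initial_ones m) \<in> hahn_space s"
  shows "Gamma_rs r s a m n =
    ennreal (hahn_norm s (seq_tail n (convolution_operator a (initial_ones m))) / r m)"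
proof -
  let ?y = "convolution_operator a (initial_ones m)"
  let ?f = "\<lambda>j. s (j + Suc n) * cmod (?y (j + Suc n) - ?y (Suc (j + Suc n)))"
  have nn: "0 \<le> ?f j" for j using hahn_weight_pos[OF s, of "j + Suc n"] by simp
  have sm: "summable ?f"
    using mem summable_iff_shift[of "\<lambda>n. s n * cmod (?y n - ?y (Suc n))" "Suc n"]
    by (simp add: hahn_space_def)
  have y: "(\<Sum>k\<le>m. zero_extend a (int n + 1 - int k)) = ?y (Suc n)"
    by (simp add: convolution_initial_ones add.commute)
  have "(\<Sum>j. let t = n + 1 + j in
      ennreal (s t * cmod (zero_extend a (int t - int m) - zero_extend a (int t + 1)))) =
      (\<Sum>j. ennreal (?f j))"
    unfolding convolution_initial_ones_diff by (simp add: Let_def add.commute)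
  also have "\<dots> = ennreal (\<Sum>j. ?f j)"
    by (rule suminf_ennreal[OF nn ennreal_suminf_neq_top[OF sm nn]])
  finally have "Gamma_rs r s a m n =
      ennreal (1 / r m) * (ennreal (s n * cmod (?y (Suc n))) + ennreal (\<Sum>j. ?f j))"
    by (simp only: Gamma_rs_def y)
  also have "\<dots> = ennreal (1 / r m * (s n * cmod (?y (Suc n)) + (\<Sum>j. ?f j)))"
    using hahn_weight_pos[OF r, of m] hahn_weight_pos[OF s, of n] suminf_nonneg[OF sm nn]
    by (simp only: ennreal_mult ennreal_plus zero_le_mult_iff norm_ge_zero less_imp_le
        zero_le_divide_1_iff add_nonneg_nonneg simp_thms)
  finally show ?thesis using hahn_tail_norm[OF s mem, of n] by simp
qed

text \<open>Summation by parts writes \<open>x\<close> as the series \<open>\<Sum>m. (x m - x (Suc m)) * initial_ones m\<close>,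
  whose coefficients satisfy \<open>\<Sum>m. r m * cmod (x m - x (Suc m)) = hahn_norm r x\<close>.\<close>

lemma hahn_tail_convolution_bound:
  assumes r: "hahn_weight r" and s: "hahn_weight s"
    and mem: "\<And>m. convolution_operator a (initial_ones m) \<in> hahn_space s"
    and bound: "\<And>m. hahn_norm s (seq_tail n (convolution_operator a (initial_ones m))) \<le> e * r m"
    and e: "0 \<le> e" and x: "x \<in> hahn_space r"
  shows "hahn_norm s (seq_tail n (convolution_operator a x)) \<le> e * hahn_norm r x"
proof -
  let ?T = "convolution_operator a"
  define \<Delta> where "\<Delta> m = x m - x (Suc m)" for m
  define X where "X M k = (\<Sum>m<M. \<Delta> m * initial_ones m k)" for M k
  define Z where "Z M t = (\<Sum>m<M. \<Delta> m * seq_tail n (?T (initial_ones m)) t)" for M t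
  have lim0: "x \<longlonglongrightarrow> 0" and sm: "summable (\<lambda>m. r m * cmod (\<Delta> m))"
    using x by (auto simp: hahn_space_def \<Delta>_def)
  \<comment> \<open>The partial sums telescope to \<open>x k - x M\<close> below \<open>M\<close>;
    the correction \<open>x M\<close> disappears in the limit because \<open>x\<close> is a null
    sequence.\<close>
  have X: "X M k = (if k < M then x k - x M else 0)" for M k
    by (induction M) (auto simp: X_def \<Delta>_def initial_ones_def less_Suc_eq)
  have Xlim: "(\<lambda>M. X M k) \<longlonglongrightarrow> x k" for k
  proof -
    have "(\<lambda>M. x k - x M) \<longlonglongrightarrow> x k - 0" by (intro tendsto_intros lim0)
    then show ?thesis
      unfolding diff_zero
      by (rule Lim_transform_eventually)
        (auto simp: X eventually_sequentially intro!: exI[of _ "Suc k"])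
  qed
  have Z: "Z M = seq_tail n (?T (X M))" for M
  proof
    fix t
    have "(\<Sum>m<M. \<Delta> m * ?T (initial_ones m) t) = ?T (X M) t"
      unfolding convolution_operator_def X_def sum_distrib_left
      by (subst sum.swap) (simp add: mult_ac)
    then show "Z M t = seq_tail n (?T (X M)) t"
      by (simp add: Z_def seq_tail_def)
  qed
  \<comment> \<open>Each coordinate of a convolution involves only finitely many coordinates of its
    argument, so coordinatewise convergence passes through the operator.\<close>
  have TX: "(\<lambda>M. ?T (X M) t) \<longlonglongrightarrow> ?T x t" for t
    unfolding convolution_operator_def by (intro tendsto_intros Xlim)
  have Zlim: "(\<lambda>M. Z M t) \<longlonglongrightarrow> seq_tail n (?T x) t" for t
    using TX by (simp add: Z seq_tail_def)
  have ZM: "Z M \<in> hahn_space s"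
    "hahn_norm s (Z M) \<le> (\<Sum>m<M. cmod (\<Delta> m) * hahn_norm s (seq_tail n (?T (initial_ones m))))" for M
    using hahn_space_sum[OF s, of "\<lambda>m. seq_tail n (?T (initial_ones m))" \<Delta> M] hahn_tail_mem[OF s mem]
    by (auto simp: Z_def[abs_def])
  have "hahn_norm s (Z M) \<le> e * hahn_norm r x" for M
  proof -
    note ZM(2)
    also have "(\<Sum>m<M. cmod (\<Delta> m) * hahn_norm s (seq_tail n (?T (initial_ones m)))) \<le>
        (\<Sum>m<M. cmod (\<Delta> m) * (e * r m))"
      by (intro sum_mono mult_left_mono bound) auto
    also have "\<dots> = e * (\<Sum>m<M. r m * cmod (\<Delta> m))"
      by (simp add: sum_distrib_left mult_ac)
    also have "(\<Sum>m<M. r m * cmod (\<Delta> m)) \<le> hahn_norm r x"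
      unfolding hahn_norm_def \<Delta>_def[symmetric]
      by (rule sum_le_suminf[OF sm]) (use hahn_weight_pos[OF r] in \<open>auto simp: less_imp_le\<close>)
    finally show ?thesis using e by (simp add: mult_left_mono)
  qed
  then show ?thesis using hahn_fatou(2)[OF s ZM(1) _ Zlim] by blast
qed

section \<open>The compactness criterion for convolution operators\<close>

theorem theorem4p7:
  fixes r s :: "nat \<Rightarrow> real" and a :: "nat \<Rightarrow> complex"
  assumes "hahn_weight r" and "hahn_weight s"
    and "a 0 \<noteq> 0" and "a 1 \<noteq> 0"
    and "bounded_hahn_operator r s (convolution_operator a)"
  shows "compact_hahn_operator r s (convolution_operator a) \<longleftrightarrow>
    limsup (\<lambda>n. SUP m. Gamma_rs r s a m n) = 0"
proof
  note r = assms(1) and s = assms(2)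
  let ?T = "convolution_operator a"
  interpret R: Metric_space "hahn_space r" "hahn_dist r" by (rule Metric_space_hahn[OF r])
  interpret S: Metric_space "hahn_space s" "hahn_dist s" by (rule Metric_space_hahn[OF s])
  have into: "?T x \<in> hahn_space s" if "x \<in> hahn_space r" for x
    using assms(5) that by (auto simp: bounded_hahn_operator_def)
  note memT = into[OF hahn_initial_ones_mem]
  note Gamma = Gamma_rs_eq[OF r s memT]
  {
    assume compact: "compact_hahn_operator r s ?T"
    \<comment> \<open>The normalized vectors \<open>initial_ones m / r m\<close> form a bounded set
      on whose images the tail norms are exactly the values of \<open>Gamma_rs\<close>.\<close>
    define B where "B = range (\<lambda>m k. complex_of_real (1 / r m) * initial_ones m k)"
    have norm1: "hahn_norm r (\<lambda>k. complex_of_real (1 / r m) * initial_ones m k) = 1" for m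
      using hahn_weight_pos[OF r, of m]
      by (subst hahn_space_scale(2)[OF hahn_initial_ones_mem])
        (simp add: norm_divide hahn_initial_ones_norm)
    have Bmem: "B \<subseteq> hahn_space r"
      by (auto simp: B_def simp del: of_real_divide
        intro!: hahn_space_scale(1) hahn_initial_ones_mem)
    have B1: "hahn_norm r x = 1" if "x \<in> B" for x using that norm1 by (auto simp: B_def)
    have "hahn_dist r x y \<le> 2" if "x \<in> B" "y \<in> B" for x y
      using hahn_space_diff(2)[OF r, of x y] that Bmem B1[of x] B1[of y]
      by (auto simp: hahn_dist_def)
    then have "R.mbounded B" using Bmem by (auto simp: R.mbounded_alt)
    then have "compactin S.mtopology (S.mtopology closure_of (?T ` B))"
      using compact by (simp add: compact_hahn_operator_def hahn_topology_def)
    then have tb: "S.mtotally_bounded (?T ` B)"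
      by (rule S.compact_closure_of_imp_mtotally_bounded) (use into Bmem in auto)
    have TB: "hahn_norm s (seq_tail n (?T (\<lambda>k. complex_of_real (1 / r m) * initial_ones m k))) =
        hahn_norm s (seq_tail n (?T (initial_ones m))) / r m" for m n
    proof -
      have "seq_tail n (?T (\<lambda>k. complex_of_real (1 / r m) * initial_ones m k)) =
          (\<lambda>t. complex_of_real (1 / r m) * seq_tail n (?T (initial_ones m)) t)"
        by (auto simp: seq_tail_def convolution_operator_def sum_distrib_left mult_ac
            simp del: of_real_divide)
      then show ?thesis
        using hahn_space_scale(2)[OF hahn_tail_mem[OF s memT], of "complex_of_real (1 / r m)"]
          hahn_weight_pos[OF r, of m]
        by (simp add: norm_divide)
    qed
    have "(\<lambda>n. SUP m. Gamma_rs r s a m n) \<longlonglongrightarrow> 0"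
    proof (rule order_tendstoI)
      fix e :: ennreal assume "0 < e"
      \<comment> \<open>\<open>e\<close> may be infinite, but anything strictly below it is finite
        and comes from a real \<open>q\<close>. The gap between \<open>e'\<close> and
        \<open>e\<close> restores the strict inequality that is lost in the supremum.\<close>
      then obtain e' where e': "0 < e'" "e' < e" using dense by blast
      then have "e' < top" using top.not_eq_extremum by fastforce
      then obtain q where q: "e' = ennreal q" "0 \<le> q" by (cases e') auto
      with e' have "0 < q" by (simp add: ennreal_less_zero_iff)
      from hahn_mtotally_bounded_imp_tails[OF s tb this]
      show "\<forall>\<^sub>F n in sequentially. (SUP m. Gamma_rs r s a m n) < e"
      proof eventually_elim
        case (elim n)
        have "Gamma_rs r s a m n \<le> e'" for m
          unfolding Gamma q using elim unfolding B_def
          by (intro ennreal_leI less_imp_le) (auto simp: TB simp del: of_real_divide)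
        then have "(SUP m. Gamma_rs r s a m n) \<le> e'" by (rule SUP_least)
        with e'(2) show ?case by simp
      qed
    qed simp
    then show "limsup (\<lambda>n. SUP m. Gamma_rs r s a m n) = 0"
      by (rule lim_imp_Limsup[rotated]) simp
  }
  {
    assume lim: "limsup (\<lambda>n. SUP m. Gamma_rs r s a m n) = 0"
    \<comment> \<open>In operator terms, the norm of the truncated operator becomes arbitrarily
      small. A limsup equal to 0 supplies a suitable \<open>n\<close> for the vectors
      \<open>initial_ones m\<close>, and \<open>hahn_tail_convolution_bound\<close> extends the
      estimate to all \<open>x\<close>.\<close>
    have unif: "\<exists>n. \<forall>x\<in>hahn_space r. hahn_norm s (seq_tail n (?T x)) \<le> e * hahn_norm r x"
      if e: "0 < e" for e
    proof -
      have "\<forall>\<^sub>F n in sequentially. (SUP m. Gamma_rs r s a m n) < ennreal e"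
        by (rule Limsup_lessD) (use lim e in simp)
      then obtain n where n: "(SUP m. Gamma_rs r s a m n) < ennreal e"
        by (auto simp: eventually_sequentially)
      have "hahn_norm s (seq_tail n (?T (initial_ones m))) \<le> e * r m" for m
      proof -
        have "Gamma_rs r s a m n < ennreal e"
          using n SUP_upper[of m UNIV "\<lambda>m. Gamma_rs r s a m n"] by (meson UNIV_I le_less_trans)
        then have "hahn_norm s (seq_tail n (?T (initial_ones m))) / r m \<le> e"
          unfolding Gamma using e by (simp add: ennreal_less_iff hahn_norm_nonneg[OF s]
            hahn_tail_mem[OF s memT] hahn_weight_pos[OF r] less_imp_le)
        then show ?thesis using hahn_weight_pos[OF r, of m] by (simp add: pos_divide_le_eq)
      qed
      then show ?thesis
        using hahn_tail_convolution_bound[OF r s memT _ less_imp_le[OF e]] by blast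
    qed
    obtain C where C: "\<And>x. x \<in> hahn_space r \<Longrightarrow> hahn_norm s (?T x) \<le> C * hahn_norm r x"
      using assms(5) unfolding bounded_hahn_operator_def by blast
    have "compactin S.mtopology (S.mtopology closure_of (?T ` B))" if B: "R.mbounded B" for B
    proof -
      have Bmem: "B \<subseteq> hahn_space r" using B by (rule R.mbounded_subset_mspace)
      obtain y K where yK: "0 < K" "B \<subseteq> R.mcball y K" using B by (auto simp: R.mbounded_pos)
      \<comment> \<open>A ball of radius \<open>K\<close> about \<open>y\<close> lies in the ball of
        radius \<open>L\<close> about 0. The absolute value keeps \<open>L\<close> positive also
        when \<open>B\<close> is empty and the centre \<open>y\<close> may lie outside the
        space.\<close>
      define L where "L = \<bar>hahn_norm r y\<bar> + K"
      have L: "hahn_norm r x \<le> L" if "x \<in> B" for x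
      proof -
        have mem: "x \<in> hahn_space r" "y \<in> hahn_space r" and "hahn_norm r (\<lambda>n. y n - x n) \<le> K"
          using yK that by (auto simp: hahn_dist_def subset_iff)
        then show ?thesis
          using hahn_space_diff(2)[OF r mem(2) hahn_space_diff(1)[OF r mem(2,1)]]
          by (simp add: L_def)
      qed
      have "0 < L" using yK by (simp add: L_def)
      have "S.mtotally_bounded (?T ` B)"
      proof (rule hahn_mtotally_bounded_if_tails[OF s])
        show "?T ` B \<subseteq> hahn_space s" using into Bmem by auto
        show "hahn_norm s z \<le> \<bar>C\<bar> * L" if z: "z \<in> ?T ` B" for z
        proof -
          obtain x where x: "x \<in> B" "z = ?T x" using z by auto
          then have "hahn_norm s z \<le> C * hahn_norm r x" using C Bmem by auto
          also have "\<dots> \<le> \<bar>C\<bar> * L"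
            using L[OF x(1)] hahn_norm_nonneg[OF r, of x] x Bmem by (intro mult_mono) auto
          finally show ?thesis .
        qed
        show "\<exists>n. \<forall>z\<in>?T ` B. hahn_norm s (seq_tail n z) \<le> e" if e: "0 < e" for e
        proof -
          obtain n where n: "\<And>x. x \<in> hahn_space r \<Longrightarrow>
              hahn_norm s (seq_tail n (?T x)) \<le> e / L * hahn_norm r x"
            using unif[of "e / L"] e \<open>0 < L\<close> by auto
          have "hahn_norm s (seq_tail n (?T x)) \<le> e" if "x \<in> B" for x
          proof -
            have "e / L * hahn_norm r x \<le> e / L * L"
              using L[OF that] e \<open>0 < L\<close> by (intro mult_left_mono) auto
            with n[of x] that Bmem \<open>0 < L\<close> show ?thesis by fastforce
          qed
          then show ?thesis by blast
        qed
      qed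
      \<comment> \<open>Completeness of the target space turns total boundedness of the image into
        compactness of its closure.\<close>
      then show ?thesis
        by (simp add: S.mtotally_bounded_eq_compact_closure_of[OF hahn_mcomplete[OF s]])
    qed
    then show "compact_hahn_operator r s ?T"
      using assms(5) by (simp add: compact_hahn_operator_def hahn_topology_def)
  }
qed

end
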